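(* Let $A\in\mathbb{R}^{m\times n}$, and let $P\in\mathbb{R}^{m\times p}$ and $Q\in\mathbb{R}^{n\times q}$ satisfy $$\mathrm{rank}(P^TA) = \mathrm{rank}(AQ) = \mathrm{rank}(A).$$ Let $P^TAQ = CR$ be a full rank factorization of $P^TAQ$. Then $$A^g = Q\,(CR)^+\,P^T$$ is a generalized $\{1,2\}$-inverse of $A$.
   Context: All matrices are real. For a matrix $M$, $M^+$ denotes its Moore–Penrose pseudoinverse. A full rank factorization of a matrix $M$ of rank $r$ is a factorization $M=CR$ in which $C$ has $r$ columns and full column rank $r$, and $R$ has $r$ rows and full row rank $r$. A $\{1,2\}$-inverse of $M$ is any matrix $G$ with $MGM=M$ and $GMG=G$. *)

theory Defs
  imports Jordan_Normal_Form.DL_Rank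
begin

text \<open>The library's rank is a constant of the locale of column vectors of a fixed length;
  the length is always the number of rows of the matrix.\<close>

abbreviation mat_rank :: "real mat \<Rightarrow> nat" where
  "mat_rank M \<equiv> vec_space.rank (dim_row M) M"

definition full_rank_factorization :: "real mat \<Rightarrow> real mat \<Rightarrow> real mat \<Rightarrow> bool" where
  "full_rank_factorization M C R \<longleftrightarrow>
     C \<in> carrier_mat (dim_row M) (mat_rank M) \<and> mat_rank C = mat_rank M \<and>
     R \<in> carrier_mat (mat_rank M) (dim_col M) \<and> mat_rank R = mat_rank M \<and>
     M = C * R"

definition is_12_inverse :: "real mat \<Rightarrow> real mat \<Rightarrow> bool" where
  "is_12_inverse M G \<longleftrightarrow>
     G \<in> carrier_mat (dim_col M) (dim_row M) \<and> M * G * M = M \<and> G * M * G = G"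

definition is_moore_penrose :: "real mat \<Rightarrow> real mat \<Rightarrow> bool" where
  "is_moore_penrose M X \<longleftrightarrow>
     X \<in> carrier_mat (dim_col M) (dim_row M) \<and>
     M * X * M = M \<and> X * M * X = X \<and>
     transpose_mat (M * X) = M * X \<and> transpose_mat (X * M) = X * M"

definition pinv :: "real mat \<Rightarrow> real mat" where
  "pinv M = (THE X. is_moore_penrose M X)"

lemma is_moore_penrose_unique:
  assumes X: "is_moore_penrose M X" and Y: "is_moore_penrose M Y"
  shows "X = Y"
proof -
  define r c where "r = dim_row M" and "c = dim_col M"
  have cM: "M \<in> carrier_mat r c" unfolding r_def c_def by (rule carrier_matI[OF refl refl])
  have cX: "X \<in> carrier_mat c r" and cY: "Y \<in> carrier_mat c r"
    using X Y by (simp_all only: is_moore_penrose_def r_def c_def)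
  have X1: "M * X * M = M" and X2: "X * M * X = X"
    and X3: "transpose_mat (M * X) = M * X" and X4: "transpose_mat (X * M) = X * M"
    using X by (simp_all only: is_moore_penrose_def)
  have Y1: "M * Y * M = M" and Y2: "Y * M * Y = Y"
    and Y3: "transpose_mat (M * Y) = M * Y" and Y4: "transpose_mat (Y * M) = Y * M"
    using Y by (simp_all only: is_moore_penrose_def)
  have MX: "M * X \<in> carrier_mat r r" and MY: "M * Y \<in> carrier_mat r r"
    and XM: "X * M \<in> carrier_mat c c" and YM: "Y * M \<in> carrier_mat c c"
    by (rule mult_carrier_mat[OF cM cX] mult_carrier_mat[OF cM cY]
         mult_carrier_mat[OF cX cM] mult_carrier_mat[OF cY cM])+
  have "M * X = (M * Y) * (M * X)" by (simp only: assoc_mult_mat[OF MY cM cX, symmetric] Y1)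
  also have "\<dots> = transpose_mat ((M * X) * (M * Y))"
    by (simp only: transpose_mult[OF MX MY] X3 Y3)
  also have "\<dots> = M * Y" by (simp only: assoc_mult_mat[OF MX cM cY, symmetric] X1 Y3)
  finally have 1: "M * X = M * Y" .
  have "X * M = (X * M) * (Y * M)"
    by (simp only: assoc_mult_mat[OF cX cM YM] assoc_mult_mat[OF cM cY cM, symmetric] Y1)
  also have "\<dots> = transpose_mat ((Y * M) * (X * M))"
    by (simp only: transpose_mult[OF YM XM] X4 Y4)
  also have "\<dots> = Y * M"
    by (simp only: assoc_mult_mat[OF cY cM XM] assoc_mult_mat[OF cM cX cM, symmetric] X1 Y4)
  finally have 2: "X * M = Y * M" .
  have "X = Y * M * X" by (simp only: 2[symmetric] X2)
  also have "\<dots> = Y * M * Y" by (simp only: assoc_mult_mat[OF cY cM cX] assoc_mult_mat[OF cY cM cY] 1)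
  finally show ?thesis by (simp only: Y2)
qed

end

theory Submission
  imports Defs
begin

text \<open>Write \<open>M = P\<^sup>T A Q\<close>. The rank hypotheses say that passing from \<open>A\<close> to \<open>P\<^sup>T A\<close> and \<open>A Q\<close> loses
  nothing, that is, \<open>A = L (P\<^sup>T A)\<close> and \<open>A = (A Q) X\<close> for some \<open>L\<close> and \<open>X\<close>. Hence
  \<open>A (Q M\<^sup>+ P\<^sup>T) A = L M M\<^sup>+ M X = L M X = A\<close>, while
  \<open>(Q M\<^sup>+ P\<^sup>T) A (Q M\<^sup>+ P\<^sup>T) = Q M\<^sup>+ M M\<^sup>+ P\<^sup>T\<close> needs no rank hypothesis.
  To obtain \<open>L\<close> and \<open>X\<close>, factor \<open>A = B K\<close> through its rank \<open>r\<close>: then \<open>P\<^sup>T A = (P\<^sup>T B) K\<close> still has rank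
  \<open>r\<close>, so \<open>P\<^sup>T B\<close> has a left inverse, and symmetrically \<open>K Q\<close> has a right inverse.\<close>

section \<open>Gram matrices and factorization through the rank\<close>

text \<open>If the Gram matrix kills \<open>v\<close>, then the squared length of
  \<open>B *\<^sub>v v\<close> is 0, so \<open>B *\<^sub>v v\<close> vanishes and injectivity gives
  \<open>v = 0\<close>.\<close>

lemma gram_inverse:
  fixes B :: "real mat"
  assumes B: "B \<in> carrier_mat m r"
    and inj: "\<And>v. v \<in> carrier_vec r \<Longrightarrow> B *\<^sub>v v = 0\<^sub>v m \<Longrightarrow> v = 0\<^sub>v r"
  obtains W where "W \<in> carrier_mat r r"
    and "W * (transpose_mat B * B) = 1\<^sub>m r" and "(transpose_mat B * B) * W = 1\<^sub>m r"
    and "transpose_mat W = W"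
proof -
  let ?G = "transpose_mat B * B"
  have G: "?G \<in> carrier_mat r r" using B by simp
  have "det ?G \<noteq> 0"
  proof
    assume "det ?G = 0"
    then obtain v where v: "v \<in> carrier_vec r" "v \<noteq> 0\<^sub>v r" "?G *\<^sub>v v = 0\<^sub>v r"
      using det_0_iff_vec_prod_zero_field[OF G] by auto
    have Bv: "B *\<^sub>v v \<in> carrier_vec m" using B v(1) by simp
    have "(B *\<^sub>v v) \<bullet> (B *\<^sub>v v) = (transpose_mat B *\<^sub>v (B *\<^sub>v v)) \<bullet> v"
      using transpose_vec_mult_scalar[OF B v(1) Bv] by simp
    also have "transpose_mat B *\<^sub>v (B *\<^sub>v v) = ?G *\<^sub>v v" using B v(1) by simp
    finally have "(B *\<^sub>v v) \<bullet> (B *\<^sub>v v) = 0" using v by simp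
    hence "B *\<^sub>v v = 0\<^sub>v m" using conjugate_square_eq_0_vec[OF Bv] by simp
    thus False using inj v by blast
  qed
  \<comment> \<open>The unit value only fills the extension slot of the record
    \<open>ring_mat\<close>.\<close>
  from det_non_zero_imp_unit[OF G this, of "()"]
  obtain W where W: "W \<in> carrier_mat r r" and WG: "W * ?G = 1\<^sub>m r" and GW: "?G * W = 1\<^sub>m r"
    unfolding Units_def ring_mat_def by auto
  have Gt: "transpose_mat ?G = ?G" using transpose_mult[of "transpose_mat B" r m B r] B by simp
  \<comment> \<open>Since \<open>?G\<close> is symmetric, transposing \<open>W * ?G = 1\<close>
    makes \<open>transpose_mat W\<close> a right inverse of \<open>?G\<close>; it must agree with
    the left inverse \<open>W\<close>.\<close>
  have GWt: "?G * transpose_mat W = 1\<^sub>m r"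
    using arg_cong[OF WG, of transpose_mat] transpose_mult[OF W G] Gt by simp
  have "transpose_mat W = W * ?G * transpose_mat W" using WG W by simp
  also have "\<dots> = W * (?G * transpose_mat W)" using W G by (intro assoc_mult_mat) auto
  also have "\<dots> = W" using GWt W by simp
  finally show ?thesis using that W WG GW by blast
qed

lemma mat_factor_through_cols:
  fixes A B :: "'a :: semiring_1 mat"
  assumes A: "A \<in> carrier_mat m n" and B: "B \<in> carrier_mat m k"
    and cols: "\<And>j. j < n \<Longrightarrow> \<exists>x \<in> carrier_vec k. B *\<^sub>v x = col A j"
  obtains X where "X \<in> carrier_mat k n" and "A = B * X"
proof -
  obtain x where x: "\<And>j. j < n \<Longrightarrow> x j \<in> carrier_vec k \<and> B *\<^sub>v x j = col A j"
    using cols by metis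
  let ?X = "mat_of_cols k (map x [0..<n])"
  have X: "?X \<in> carrier_mat k n" using mat_of_cols_carrier(1)[of k "map x [0..<n]"] by simp
  have "A = B * ?X"
  proof (rule mat_col_eqI)
    fix j assume "j < dim_col (B * ?X)"
    hence j: "j < n" by simp
    hence "col ?X j = x j" using x by (subst col_mat_of_cols) auto
    thus "col A j = col (B * ?X) j" using col_mult2[OF B X j] x j by simp
  qed (use A B in auto)
  with X show ?thesis by (rule that)
qed

text \<open>\<open>B\<close> collects a maximal independent set of columns of \<open>A\<close>, and
  \<open>K\<close> holds the coordinates of all columns of \<open>A\<close> in it. \<open>S\<close>
  writes the columns of \<open>B\<close> back in terms of those of \<open>A\<close>, and
  \<open>Z\<close> is a left inverse of \<open>B\<close> built from its Gram matrix.\<close>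

lemma rank_decomposition:
  fixes A :: "real mat"
  assumes A: "A \<in> carrier_mat m n" and r: "r = mat_rank A"
  obtains B K S Z where "B \<in> carrier_mat m r" and "K \<in> carrier_mat r n"
    and "S \<in> carrier_mat n r" and "Z \<in> carrier_mat r m"
    and "A = B * K" and "B = A * S" and "Z * B = 1\<^sub>m r" and "K * S = 1\<^sub>m r"
proof -
  interpret vec_space "TYPE(real)" m .
  let ?P = "\<lambda>T. T \<subseteq> set (cols A) \<and> lin_indpt T"
  have cA: "set (cols A) \<subseteq> carrier_vec m" using A cols_dim by blast
  have "lin_indpt {}"
    using subset_li_is_li[of _ "{}"] finite_basis_exists[OF fin_dim] unfolding basis_def by blast
  then obtain U where fin: "finite U" and max: "maximal U ?P"
    using maximal_exists_superset[of "set (cols A)" ?P "{}"] by blast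
  have U: "U \<subseteq> set (cols A)" "lin_indpt U" using max unfolding maximal_def by auto
  have UV: "U \<subseteq> carrier_vec m" using U(1) cA by blast
  have card: "card U = r" using rank_card_indpt[OF A max] r A by simp
  \<comment> \<open>A column outside the span could be added to \<open>U\<close> without losing
    independence, against maximality.\<close>
  have span: "c \<in> span U" if c: "c \<in> set (cols A)" for c
  proof (rule ccontr)
    assume nc: "c \<notin> span U"
    have cV: "c \<in> carrier_vec m" using c cA by blast
    have "c \<notin> U" using nc UV in_own_span by auto
    hence "lin_indpt (U \<union> {c})"
      using lin_dep_iff_in_span[of U c] UV U(2) cV nc by auto
    hence "U \<union> {c} = U" using max U(1) c unfolding maximal_def by blast
    with \<open>c \<notin> U\<close> show False by blast
  qed
  obtain bs where bs: "set bs = U" "distinct bs" using fin finite_distinct_list by blast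
  hence len: "length bs = r" using card distinct_card by metis
  define B where "B = mat_of_cols m bs"
  have B: "B \<in> carrier_mat m r" using len mat_of_cols_carrier(1)[of m bs] by (simp add: B_def)
  have colsB: "cols B = bs" unfolding B_def using bs UV by (intro cols_mat_of_cols) simp
  have "\<exists>x \<in> carrier_vec r. B *\<^sub>v x = col A j" if j: "j < n" for j
  proof -
    have "col A j \<in> set (cols A)" using j A by (auto simp: cols_def)
    hence "col A j \<in> col_space B" using span bs colsB by (simp add: col_space_def)
    thus ?thesis using col_space_eq[OF B] B by auto
  qed
  from mat_factor_through_cols[OF A B this]
  obtain K where K: "K \<in> carrier_mat r n" and AK: "A = B * K" by blast
  have "\<exists>x \<in> carrier_vec n. A *\<^sub>v x = col B j" if j: "j < r" for j
  proof -
    have "col B j \<in> set (cols B)" using j B by (auto simp: cols_def)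
    hence "col B j \<in> set (cols A)" using U bs colsB by auto
    hence "col B j \<in> col_space A" unfolding col_space_def using in_own_span[OF cA] by blast
    thus ?thesis using col_space_eq[OF A] A by auto
  qed
  from mat_factor_through_cols[OF B A this]
  obtain S where S: "S \<in> carrier_mat n r" and BS: "B = A * S" by blast
  \<comment> \<open>Independence is a property of the set of columns; it speaks about
    \<open>B\<close> because the list \<open>bs\<close> has no repetitions.\<close>
  have inj: "v = 0\<^sub>v r" if "v \<in> carrier_vec r" "B *\<^sub>v v = 0\<^sub>v m" for v
    using lin_depI[OF B that(1) _ that(2)] U(2) bs colsB by auto
  from gram_inverse[OF B inj] obtain W
    where W: "W \<in> carrier_mat r r" "W * (transpose_mat B * B) = 1\<^sub>m r" by blast
  define Z where "Z = W * transpose_mat B"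
  have Z: "Z \<in> carrier_mat r m" using W B by (simp add: Z_def)
  have ZB: "Z * B = 1\<^sub>m r" using W B unfolding Z_def
    by (metis assoc_mult_mat transpose_carrier_mat)
  \<comment> \<open>\<open>B * (K * S) = A * S = B\<close>, and \<open>Z\<close> cancels
    \<open>B\<close> on the left.\<close>
  have "K * S = (Z * B) * (K * S)" using ZB K S by simp
  also have "\<dots> = Z * (B * (K * S))" using Z B K S by (intro assoc_mult_mat) auto
  also have "B * (K * S) = B" using AK BS B K S by (metis assoc_mult_mat)
  finally have "K * S = 1\<^sub>m r" using ZB by simp
  with B K S Z AK BS ZB show ?thesis by (rule that)
qed

text \<open>Decomposing \<open>F * G\<close> gives \<open>(Z * F) * (G * S) = 1\<close>. Both
  factors are square of size \<open>r\<close>, so they also multiply to 1 in the other order, which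
  yields the witnesses \<open>G * S * Z\<close> and \<open>S * (Z * F)\<close>.\<close>

lemma full_rank_factor_inverses:
  fixes F G :: "real mat"
  assumes F: "F \<in> carrier_mat m r" and G: "G \<in> carrier_mat r n"
    and rank: "mat_rank (F * G) = r"
  obtains L X where "L \<in> carrier_mat r m" and "X \<in> carrier_mat n r"
    and "L * F = 1\<^sub>m r" and "G * X = 1\<^sub>m r"
proof -
  have FG: "F * G \<in> carrier_mat m n" using F G by simp
  from rank_decomposition[OF FG rank[symmetric]]
  obtain B K S Z where S: "S \<in> carrier_mat n r" and Z: "Z \<in> carrier_mat r m"
    and B: "B = F * G * S" and ZB: "Z * B = 1\<^sub>m r" by metis
  have ZF: "Z * F \<in> carrier_mat r r" and GS: "G * S \<in> carrier_mat r r" using Z F G S by auto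
  have "(Z * F) * (G * S) = Z * (F * (G * S))" using Z F GS by (rule assoc_mult_mat)
  also have "F * (G * S) = B" unfolding B using F G S by (rule assoc_mult_mat[symmetric])
  finally have "(Z * F) * (G * S) = 1\<^sub>m r" using ZB by simp
  note inv = mat_mult_left_right_inverse[OF ZF GS this]
  show ?thesis
  proof (rule that)
    show "G * S * Z \<in> carrier_mat r m" using GS Z by simp
    show "S * (Z * F) \<in> carrier_mat n r" using ZF S by simp
    show "G * S * Z * F = 1\<^sub>m r" using inv assoc_mult_mat[OF GS Z F] by simp
    show "G * (S * (Z * F)) = 1\<^sub>m r" using inv assoc_mult_mat[OF G S ZF] by simp
  qed
qed

lemma left_inverse_inj:
  fixes B :: "'a :: semiring_1 mat"
  assumes "Z \<in> carrier_mat r m" and "B \<in> carrier_mat m r" and "Z * B = 1\<^sub>m r"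
    and "v \<in> carrier_vec r" and "B *\<^sub>v v = 0\<^sub>v m"
  shows "v = 0\<^sub>v r"
proof -
  have "v = (Z * B) *\<^sub>v v" using assms by simp
  also have "\<dots> = Z *\<^sub>v (B *\<^sub>v v)" using assms by (intro assoc_mult_mat_vec) auto
  also have "\<dots> = 0\<^sub>v r" using assms(1,5) by (auto intro!: eq_vecI)
  finally show ?thesis .
qed

section \<open>Existence of the Moore-Penrose inverse\<close>

text \<open>For \<open>M = B * K\<close> the witness is the classical product of
  \<open>Y = K^T (K K^T)^-1\<close> and \<open>T = (B^T B)^-1 B^T\<close>. As
  \<open>T * B = 1\<close> and \<open>K * Y = 1\<close>, the two products with \<open>M\<close>
  reduce to \<open>B * T\<close> and \<open>Y * K\<close>, both symmetric.\<close>

lemma moore_penrose_exists: "\<exists>X. is_moore_penrose M X"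
proof -
  define m n r where "m = dim_row M" and "n = dim_col M" and "r = mat_rank M"
  have M: "M \<in> carrier_mat m n" by (simp add: m_def n_def)
  from rank_decomposition[OF M r_def] obtain B K S Z
    where B: "B \<in> carrier_mat m r" and K: "K \<in> carrier_mat r n"
      and S: "S \<in> carrier_mat n r" and Z: "Z \<in> carrier_mat r m"
      and MBK: "M = B * K" and ZB: "Z * B = 1\<^sub>m r" and KS: "K * S = 1\<^sub>m r" by metis
  let ?Bt = "transpose_mat B" and ?Kt = "transpose_mat K"
  have Bt: "?Bt \<in> carrier_mat r m" and Kt: "?Kt \<in> carrier_mat n r"
    and St: "transpose_mat S \<in> carrier_mat r n" using B K S by auto
  have SKt: "transpose_mat S * ?Kt = 1\<^sub>m r"
    using arg_cong[OF KS, of transpose_mat] transpose_mult[OF K S] by simp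
  obtain W where W: "W \<in> carrier_mat r r" and WB: "W * (?Bt * B) = 1\<^sub>m r"
    and Wt: "transpose_mat W = W"
    using gram_inverse[OF B left_inverse_inj[OF Z B ZB]] by metis
  \<comment> \<open>The Gram matrix of \<open>?Kt\<close> is \<open>K * ?Kt\<close>;
    \<open>?Kt\<close> is injective because the transpose of \<open>S\<close> is a left inverse of
    it.\<close>
  obtain V where V: "V \<in> carrier_mat r r" and KV: "(K * ?Kt) * V = 1\<^sub>m r"
    and Vt: "transpose_mat V = V"
    using gram_inverse[OF Kt left_inverse_inj[OF St Kt SKt]] by (metis Matrix.transpose_transpose)
  define Y where "Y = ?Kt * V"
  define T where "T = W * ?Bt"
  have Y: "Y \<in> carrier_mat n r" and T: "T \<in> carrier_mat r m"
    using Kt V W Bt by (simp_all add: Y_def T_def)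
  have TB: "T * B = 1\<^sub>m r" using assoc_mult_mat[OF W Bt B] WB by (simp add: T_def)
  have KY: "K * Y = 1\<^sub>m r" using assoc_mult_mat[OF K Kt V] KV by (simp add: Y_def)
  have YT: "Y * T \<in> carrier_mat n m" using Y T by simp
  have "M * (Y * T) = B * (K * (Y * T))" unfolding MBK using B K YT by (rule assoc_mult_mat)
  also have "K * (Y * T) = T" using assoc_mult_mat[OF K Y T] KY T by simp
  finally have MX: "M * (Y * T) = B * T" .
  have "(Y * T) * M = Y * (T * (B * K))" unfolding MBK
    using B K Y T by (intro assoc_mult_mat) auto
  also have "T * (B * K) = K" using assoc_mult_mat[OF T B K] TB K by simp
  finally have XM: "(Y * T) * M = Y * K" .
  have "transpose_mat T = B * W" unfolding T_def using transpose_mult[OF W Bt] Wt by simp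
  hence "transpose_mat (B * T) = B * W * ?Bt" using transpose_mult[OF B T] by simp
  hence sBT: "transpose_mat (B * T) = B * T"
    unfolding T_def using assoc_mult_mat[OF B W Bt] by simp
  have "transpose_mat Y = V * K" unfolding Y_def using transpose_mult[OF Kt V] Vt by simp
  hence "transpose_mat (Y * K) = ?Kt * (V * K)" using transpose_mult[OF Y K] by simp
  hence sYK: "transpose_mat (Y * K) = Y * K"
    unfolding Y_def using assoc_mult_mat[OF Kt V K] by simp
  have "B * T * M = B * (T * (B * K))" unfolding MBK
    using B T K by (intro assoc_mult_mat) auto
  hence MXM: "B * T * M = M" using \<open>T * (B * K) = K\<close> MBK by simp
  have "Y * K * (Y * T) = Y * (K * (Y * T))" using Y K YT by (rule assoc_mult_mat)
  hence XMX: "Y * K * (Y * T) = Y * T" using \<open>K * (Y * T) = T\<close> by simp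
  have "is_moore_penrose M (Y * T)"
    unfolding is_moore_penrose_def MX XM using YT MXM XMX sBT sYK by (simp add: m_def n_def)
  thus ?thesis by blast
qed

text \<open>Existence and \<open>is_moore_penrose_unique\<close> together make the definite
  description in \<open>pinv\<close> denote.\<close>

lemma is_moore_penrose_pinv: "is_moore_penrose M (pinv M)"
  unfolding pinv_def using moore_penrose_exists is_moore_penrose_unique by (metis theI)

section \<open>Recovering a matrix from rank-preserving products\<close>

text \<open>The witness is \<open>B * L\<close>, where \<open>A = B * K\<close> is a rank
  decomposition and \<open>L\<close> is a left inverse of \<open>D * B\<close>.\<close>

lemma rank_preserving_left_mult:
  fixes A D :: "real mat"
  assumes A: "A \<in> carrier_mat m n" and D: "D \<in> carrier_mat p m"
    and rank: "mat_rank (D * A) = mat_rank A"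
  obtains L where "L \<in> carrier_mat m p" and "A = L * (D * A)"
proof -
  define r where "r = mat_rank A"
  from rank_decomposition[OF A r_def] obtain B K
    where B: "B \<in> carrier_mat m r" and K: "K \<in> carrier_mat r n" and ABK: "A = B * K" by metis
  have DB: "D * B \<in> carrier_mat p r" using D B by simp
  have eq: "D * A = D * B * K" unfolding ABK using D B K by (rule assoc_mult_mat[symmetric])
  from full_rank_factor_inverses[OF DB K] obtain L
    where L: "L \<in> carrier_mat r p" and LDB: "L * (D * B) = 1\<^sub>m r"
    using rank eq r_def by metis
  have "(B * L) * (D * A) = B * (L * (D * B * K))" unfolding eq
    using B L mult_carrier_mat[OF DB K] by (rule assoc_mult_mat)
  also have "L * (D * B * K) = K" using assoc_mult_mat[OF L DB K] LDB K by simp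
  finally have "A = (B * L) * (D * A)" using ABK by simp
  moreover have "B * L \<in> carrier_mat m p" using B L by simp
  ultimately show ?thesis using that by blast
qed

text \<open>Mirror image with the witness \<open>X * K\<close>, where \<open>X\<close> is a right
  inverse of \<open>K * D\<close>. Arguing directly instead of by transposition avoids comparing row
  and column rank.\<close>

lemma rank_preserving_right_mult:
  fixes A D :: "real mat"
  assumes A: "A \<in> carrier_mat m n" and D: "D \<in> carrier_mat n q"
    and rank: "mat_rank (A * D) = mat_rank A"
  obtains X where "X \<in> carrier_mat q n" and "A = (A * D) * X"
proof -
  define r where "r = mat_rank A"
  from rank_decomposition[OF A r_def] obtain B K
    where B: "B \<in> carrier_mat m r" and K: "K \<in> carrier_mat r n" and ABK: "A = B * K" by metis
  have KD: "K * D \<in> carrier_mat r q" using K D by simp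
  have eq: "A * D = B * (K * D)" unfolding ABK using B K D by (rule assoc_mult_mat)
  from full_rank_factor_inverses[OF B KD] obtain X
    where X: "X \<in> carrier_mat q r" and KDX: "(K * D) * X = 1\<^sub>m r"
    using rank eq r_def by metis
  have "(A * D) * (X * K) = B * ((K * D) * (X * K))" unfolding eq
    using B KD mult_carrier_mat[OF X K] by (rule assoc_mult_mat)
  also have "(K * D) * (X * K) = K" using assoc_mult_mat[OF KD X K] KDX K by simp
  finally have "A = (A * D) * (X * K)" using ABK by simp
  moreover have "X * K \<in> carrier_mat q n" using X K by simp
  ultimately show ?thesis using that by blast
qed

section \<open>The two defining identities of the generalized inverse\<close>

theorem theorem6:
  fixes A P Q C R :: "real mat" and m n p q :: nat
  assumes "A \<in> carrier_mat m n"
    and "P \<in> carrier_mat m p"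
    and "Q \<in> carrier_mat n q"
    and "mat_rank (transpose_mat P * A) = mat_rank A"
    and "mat_rank (A * Q) = mat_rank A"
    and "full_rank_factorization (transpose_mat P * A * Q) C R"
  shows "is_12_inverse A (Q * pinv (C * R) * transpose_mat P)"
proof -
  note A = assms(1) and Q = assms(3)
  define D where "D = transpose_mat P"
  have D: "D \<in> carrier_mat p m" using assms(2) by (simp add: D_def)
  define M where "M = D * A * Q"
  have M: "M \<in> carrier_mat p q" using D A Q by (simp add: M_def)
  have CR: "C * R = M" using assms(6) by (simp add: full_rank_factorization_def M_def D_def)
  define Y where "Y = pinv M"
  have "is_moore_penrose M Y" unfolding Y_def by (rule is_moore_penrose_pinv)
  hence Y: "Y \<in> carrier_mat q p" and MYM: "M * Y * M = M" and YMY: "Y * M * Y = Y"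
    using M by (auto simp: is_moore_penrose_def)
  obtain L where L: "L \<in> carrier_mat m p" and AL: "A = L * (D * A)"
    using rank_preserving_left_mult[OF A D] assms(4) D_def by metis
  obtain X where X: "X \<in> carrier_mat q n" and AX: "A = A * Q * X"
    using rank_preserving_right_mult[OF A Q assms(5)] by metis
  define G where "G = Q * Y * D"
  have G: "G \<in> carrier_mat n m" using Q Y D by (simp add: G_def)
  have DA: "D * A \<in> carrier_mat p n" and AQ: "A * Q \<in> carrier_mat m q"
    and YD: "Y * D \<in> carrier_mat q m" and QY: "Q * Y \<in> carrier_mat n p"
    and YM: "Y * M \<in> carrier_mat q q" and MX: "M * X \<in> carrier_mat p n"
    using A D Q Y M X by auto
  \<comment> \<open>This and \<open>DAX\<close> put \<open>M\<close> on both sides of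
    \<open>Y\<close> in \<open>A * G * A\<close>, so that \<open>M * Y * M = M\<close>
    applies.\<close>
  have AQL: "A * Q = L * M"
    unfolding M_def using AL assoc_mult_mat[OF L DA Q] by simp
  have M': "M = D * (A * Q)" unfolding M_def using D A Q by (rule assoc_mult_mat)
  have DAX: "D * A = M * X"
    unfolding M' using AX assoc_mult_mat[OF D AQ X] by simp
  have "A * G = A * Q * (Y * D)"
    unfolding G_def using assoc_mult_mat[OF Q Y D] assoc_mult_mat[OF A Q YD] by simp
  hence "A * G * A = A * Q * (Y * D * A)" using assoc_mult_mat[OF AQ YD A] by simp
  also have "Y * D * A = Y * (M * X)" using assoc_mult_mat[OF Y D A] DAX by simp
  also have "\<dots> = Y * M * X" using assoc_mult_mat[OF Y M X] by simp
  also have "A * Q * (Y * M * X) = L * (M * (Y * M * X))"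
    unfolding AQL using L M mult_carrier_mat[OF YM X] by (rule assoc_mult_mat)
  also have "M * (Y * M * X) = M * Y * M * X"
    using assoc_mult_mat[OF M YM X] assoc_mult_mat[OF M Y M] by simp
  also have "L * (M * Y * M * X) = A" using MYM DAX AL by simp
  finally have 1: "A * G * A = A" .
  \<comment> \<open>In \<open>G * A * G\<close> the inner factors \<open>D * A * Q\<close> form
    \<open>M\<close>, and \<open>Y * M * Y = Y\<close> collapses the middle.\<close>
  have "G * A = Q * Y * (D * A)" unfolding G_def using QY D A by (rule assoc_mult_mat)
  hence "G * A * G = Q * Y * (D * A * G)" using assoc_mult_mat[OF QY DA G] by simp
  also have "D * A * G = M * (Y * D)"
    unfolding G_def M_def using assoc_mult_mat[OF Q Y D] assoc_mult_mat[OF DA Q YD] by simp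
  also have "Q * Y * (M * (Y * D)) = Q * (Y * (M * (Y * D)))"
    using Q Y mult_carrier_mat[OF M YD] by (rule assoc_mult_mat)
  also have "Y * (M * (Y * D)) = Y * M * Y * D"
    using assoc_mult_mat[OF Y M YD] assoc_mult_mat[OF YM Y D] by simp
  also have "Q * (Y * M * Y * D) = G"
    unfolding YMY G_def using Q Y D by (rule assoc_mult_mat[symmetric])
  finally have "G * A * G = G" .
  with 1 G A have "is_12_inverse A G" by (simp add: is_12_inverse_def)
  thus ?thesis by (simp add: G_def Y_def D_def CR)
qed

end
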